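(* Let $n \geqslant 1$ be an integer, let $v_1, \dots, v_n > 0$ be real numbers, and let $$\bar{v} = \frac{1}{n} \sum_{i=1}^n v_i \quad \text{and} \quad \operatorname{Var}(v)=\frac{1}{n} \sum_{i=1}^n \left( v_i - \bar{v} \right)^2 .$$ Let $X_1, \dots, X_n$ be independent real random variables such that, for every $i \in \{1,\dots,n\}$, $X_i$ is uniformly distributed on the interval $[-v_i, v_i]$. For $\lambda, t > 0$ define $$\tilde{\psi}(\lambda,t) = -\lambda t + \lambda n \bar{v} + n \log \left( \frac{1- e^{-2\lambda \bar{v}}}{2 \lambda \bar{v}} \right) + \frac{n \lambda^2 \operatorname{Var}(v)}{2}.$$ Then, for all $t > 0$ and every $\lambda_0 > 0$ such that $\frac{\partial \tilde{\psi}}{\partial \lambda}(\lambda_0,t) = 0$, $$\mathbb{P}\left( \left| \sum_{i=1}^n X_i \right| \geqslant t \right) \leqslant 2 \exp \left( \tilde{\psi}(\lambda_0,t) \right).$$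
   Context: $\log$ denotes the natural logarithm. *)

theory Defs
  imports "HOL-Probability.Probability"
begin

definition emp_mean :: "nat \<Rightarrow> (nat \<Rightarrow> real) \<Rightarrow> real" where
  "emp_mean n v = (1 / real n) * (\<Sum>i = 1..n. v i)"

definition emp_variance :: "nat \<Rightarrow> (nat \<Rightarrow> real) \<Rightarrow> real" where
  "emp_variance n v = (1 / real n) * (\<Sum>i = 1..n. (v i - emp_mean n v)\<^sup>2)"

(* Intended for l > 0 and emp_mean n v > 0, so that no division by zero occurs. *)
definition psi_tilde :: "nat \<Rightarrow> (nat \<Rightarrow> real) \<Rightarrow> real \<Rightarrow> real \<Rightarrow> real" where
  "psi_tilde n v l t =
     - l * t + l * real n * emp_mean n v
     + real n * ln ((1 - exp (- 2 * l * emp_mean n v)) / (2 * l * emp_mean n v))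
     + real n * l\<^sup>2 * emp_variance n v / 2"

end

theory Submission
  imports Defs
begin

text \<open>
  The moment generating function of the uniform distribution on \<open>[-v, v]\<close> is
  \<open>s \<mapsto> sinh (s v) / (s v)\<close>, so Chernoff's bound applies to both tails. Since
  \<open>tanh x \<le> x\<close>, the second derivative \<open>1 / x\<^sup>2 - 1 / (sinh x)\<^sup>2\<close> of \<open>ln (sinh x / x)\<close>
  is at most 1; hence \<open>x\<^sup>2 / 2 - ln (sinh x / x)\<close> is convex, and Jensen's inequality replaces each
  \<open>v\<^sub>i\<close> by the mean at the cost of the variance term.
\<close>

text \<open>The difference \<open>x * cosh x - sinh x\<close> vanishes at 0 and has derivative
  \<open>x * sinh x\<close>, which is nonnegative for \<open>x \<ge> 0\<close>. This is tanh x \<le>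
  x cleared of its denominator.\<close>

lemma sinh_le_mult_cosh:
  fixes x :: real
  assumes "x \<ge> 0"
  shows "sinh x \<le> x * cosh x"
proof -
  have "0 * cosh 0 - sinh 0 \<le> x * cosh x - sinh x"
  proof (rule DERIV_nonneg_imp_nondecreasing[OF assms])
    fix y :: real assume "0 \<le> y" "y \<le> x"
    have "((\<lambda>x. x * cosh x - sinh x) has_real_derivative y * sinh y) (at y)"
      by (auto intro!: derivative_eq_intros)
    then show "\<exists>d. ((\<lambda>x. x * cosh x - sinh x) has_real_derivative d) (at y) \<and> 0 \<le> d"
      using \<open>0 \<le> y\<close> by (intro exI[of _ "y * sinh y"]) auto
  qed
  then show ?thesis by simp
qed

lemma convex_on_half_square_minus_ln_sinhc:
  "convex_on {0<..} (\<lambda>x::real. x\<^sup>2 / 2 - ln (sinh x / x))"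
proof (rule f''_ge0_imp_convex)
  show "convex {0::real<..}" by (rule convex_real_interval)
next
  fix x :: real assume "x \<in> {0<..}"
  then have x: "x > 0" and s: "sinh x > 0" by auto
  show "((\<lambda>x. x\<^sup>2 / 2 - ln (sinh x / x)) has_real_derivative x - cosh x / sinh x + 1 / x) (at x)"
    using x s by (auto intro!: derivative_eq_intros simp: field_simps power2_eq_square)
  \<comment> \<open>This identity turns 1 + 1 / sinh^2, the derivative of x - coth x, into coth^2.
    The second derivative becomes a difference of two squares, and comparing their bases
    suffices.\<close>
  have cs: "(cosh x)\<^sup>2 = (sinh x)\<^sup>2 + 1" by (simp add: cosh_square_eq)
  show "((\<lambda>x. x - cosh x / sinh x + 1 / x) has_real_derivative
      (cosh x / sinh x)\<^sup>2 - (1 / x)\<^sup>2) (at x)"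
    using x s cs by (auto intro!: derivative_eq_intros simp: field_simps power2_eq_square)
  have "1 / x \<le> cosh x / sinh x"
    using sinh_le_mult_cosh[of x] x s by (simp add: field_simps)
  then show "0 \<le> (cosh x / sinh x)\<^sup>2 - (1 / x)\<^sup>2"
    using x power_mono[of "1 / x" "cosh x / sinh x" 2] by simp
qed

lemma emp_variance_alt:
  assumes "n \<ge> 1"
  shows "emp_variance n v = (1 / real n) * (\<Sum>i = 1..n. (v i)\<^sup>2) - (emp_mean n v)\<^sup>2"
proof -
  define m where "m = emp_mean n v"
  have S: "(\<Sum>i = 1..n. v i) = real n * m"
    using assms by (simp add: m_def emp_mean_def)
  have "(\<Sum>i = 1..n. (v i - m)\<^sup>2) = (\<Sum>i = 1..n. (v i)\<^sup>2 - 2 * m * v i + m\<^sup>2)"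
    by (intro sum.cong) (simp_all add: power2_diff algebra_simps)
  also have "\<dots> = (\<Sum>i = 1..n. (v i)\<^sup>2) - 2 * m * (\<Sum>i = 1..n. v i) + real n * m\<^sup>2"
    by (simp add: sum.distrib sum_subtractf sum_distrib_left)
  also have "\<dots> = (\<Sum>i = 1..n. (v i)\<^sup>2) - real n * m\<^sup>2"
    by (simp only: S) (simp add: power2_eq_square)
  finally show ?thesis
    using assms by (simp add: emp_variance_def m_def[symmetric] right_diff_distrib diff_divide_distrib)
qed

lemma emp_mean_pos:
  assumes "n \<ge> 1" "\<And>i. i \<in> {1..n} \<Longrightarrow> v i > 0"
  shows "emp_mean n v > 0"
  unfolding emp_mean_def using assms by (intro mult_pos_pos sum_pos) auto

text \<open>Jensen's inequality with equal weights at the points \<open>l * v i\<close>, whose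
  average is \<open>l * m\<close>. The logarithmic parts give the two sides, and the gap between the
  quadratic parts is the variance term.\<close>

lemma sum_ln_sinhc_le:
  assumes n: "n \<ge> 1" and v: "\<And>i. i \<in> {1..n} \<Longrightarrow> v i > 0" and l: "l > 0"
  defines "m \<equiv> emp_mean n v"
  shows "(\<Sum>i = 1..n. ln (sinh (l * v i) / (l * v i)))
    \<le> real n * ln (sinh (l * m) / (l * m)) + real n * l\<^sup>2 * emp_variance n v / 2"
proof -
  let ?f = "\<lambda>x::real. x\<^sup>2 / 2 - ln (sinh x / x)"
  let ?S = "\<Sum>i = 1..n. ln (sinh (l * v i) / (l * v i))"
  have "?f (\<Sum>i\<in>{1..n}. (1 / real n) *\<^sub>R (l * v i)) \<le> (\<Sum>i\<in>{1..n}. (1 / real n) * ?f (l * v i))"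
    using n l v by (intro convex_on_sum[OF _ _ convex_on_half_square_minus_ln_sinhc]) auto
  also have "(\<Sum>i\<in>{1..n}. (1 / real n) *\<^sub>R (l * v i)) = l * m"
    by (simp add: m_def emp_mean_def sum_distrib_left mult_ac)
  also have "(\<Sum>i\<in>{1..n}. (1 / real n) * ?f (l * v i))
      = (1 / real n) * (l\<^sup>2 / 2 * (\<Sum>i = 1..n. (v i)\<^sup>2) - ?S)"
    by (simp add: sum_distrib_left[symmetric] sum_subtractf sum_divide_distrib[symmetric]
        power_mult_distrib)
  finally have "real n * ?f (l * m) \<le> l\<^sup>2 / 2 * (\<Sum>i = 1..n. (v i)\<^sup>2) - ?S"
    using n by (simp add: field_simps)
  \<comment> \<open>After this substitution the \<open>m\<^sup>2\<close> contribution cancels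
    against the quadratic part of \<open>?f (l * m)\<close>.\<close>
  moreover have "(\<Sum>i = 1..n. (v i)\<^sup>2) = real n * (emp_variance n v + m\<^sup>2)"
    using n by (simp add: emp_variance_alt m_def)
  ultimately show ?thesis
    by (simp add: algebra_simps power_mult_distrib)
qed

text \<open>Factoring \<open>exp x\<close> out of \<open>sinh x\<close> at
  \<open>x = l * emp_mean n v\<close> shows that the term \<open>l * real n * emp_mean n v\<close>
  of \<open>psi_tilde\<close> is the logarithm of that factor, taken \<open>n\<close> times.\<close>

lemma psi_tilde_eq_ln_sinhc:
  fixes l t :: real
  assumes "l > 0" "emp_mean n v > 0"
  shows "psi_tilde n v l t = - l * t
    + real n * ln (sinh (l * emp_mean n v) / (l * emp_mean n v))
    + real n * l\<^sup>2 * emp_variance n v / 2"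
proof -
  define x where "x = l * emp_mean n v"
  have x: "x > 0" using assms by (simp add: x_def)
  have "sinh x / x = exp x * ((1 - exp (- 2 * x)) / (2 * x))"
    using x by (simp add: sinh_def field_simps flip: exp_add)
  moreover have "exp (- 2 * x) < 1" using x by simp
  ultimately have "ln (sinh x / x) = x + ln ((1 - exp (- 2 * x)) / (2 * x))"
    using x ln_mult[of "exp x" "(1 - exp (- 2 * x)) / (2 * x)"] by simp
  then show ?thesis
    by (simp add: psi_tilde_def x_def algebra_simps)
qed

text \<open>Both signs of \<open>s\<close> are allowed, so that the same formula serves the upper
  and the lower tail.\<close>

lemma nn_integral_exp_uniform:
  fixes X :: "'a \<Rightarrow> real" and s v :: real
  assumes v: "v > 0" and s: "s \<noteq> 0"
    and X: "distributed M lborel X (\<lambda>x. indicator {- v..v} x / measure lborel {- v..v})"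
  shows "(\<integral>\<^sup>+\<omega>. ennreal (exp (s * X \<omega>)) \<partial>M) = ennreal (sinh (s * v) / (s * v))"
proof -
  have d: "distributed M lborel X (\<lambda>x. ennreal (indicator {- v..v} x / measure lborel {- v..v}))"
    using X by simp
  have "(\<integral>\<^sup>+\<omega>. ennreal (exp (s * X \<omega>)) \<partial>M)
      = (\<integral>\<^sup>+x. ennreal (indicator {- v..v} x / measure lborel {- v..v}) * ennreal (exp (s * x)) \<partial>lborel)"
    by (rule distributed_nn_integral[OF d, symmetric]) simp
  also have "\<dots> = (\<integral>\<^sup>+x. ennreal (exp (s * x) / (2 * v)) * indicator {- v..v} x \<partial>lborel)"
    using v by (intro nn_integral_cong) (auto simp: indicator_def simp flip: ennreal_mult)
  \<comment> \<open>The antiderivative is \<open>exp (s * x) / (2 * v * s)\<close>, where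
    \<open>2 * v\<close> is the length of the interval.\<close>
  also have "\<dots> = ennreal (exp (s * v) / (2 * v * s) - exp (s * - v) / (2 * v * s))"
    using v s by (intro nn_integral_FTC_Icc) (auto intro!: derivative_eq_intros)
  also have "exp (s * v) / (2 * v * s) - exp (s * - v) / (2 * v * s) = sinh (s * v) / (s * v)"
    using v s by (simp add: sinh_def field_simps)
  finally show ?thesis .
qed

text \<open>Markov's inequality for the exponential of the sum, whose expectation factors by
  independence. Working with nonnegative integrals avoids integrability obligations.\<close>

lemma (in prob_space) Chernoff_indep_vars_ge:
  fixes X :: "'b \<Rightarrow> 'a \<Rightarrow> real" and s a :: real
  assumes fin: "finite I" and indep: "indep_vars (\<lambda>_. borel) X I" and s: "s > 0"
    and mgf: "\<And>i. i \<in> I \<Longrightarrow> (\<integral>\<^sup>+\<omega>. ennreal (exp (s * X i \<omega>)) \<partial>M) \<le> ennreal (m i)"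
    and m: "\<And>i. i \<in> I \<Longrightarrow> m i \<ge> 0"
  shows "prob {\<omega> \<in> space M. a \<le> (\<Sum>i\<in>I. X i \<omega>)} \<le> exp (- s * a) * (\<Prod>i\<in>I. m i)"
proof -
  have [measurable]: "random_variable borel (X i)" if "i \<in> I" for i
    using indep that by (auto simp: indep_vars_def)
  have "ennreal (prob {\<omega> \<in> space M. a \<le> (\<Sum>i\<in>I. X i \<omega>)})
      \<le> ennreal (exp (- s * a)) * (\<integral>\<^sup>+\<omega>\<in>space M. ennreal (exp (s * (\<Sum>i\<in>I. X i \<omega>))) \<partial>M)"
    unfolding emeasure_eq_measure[symmetric] by (intro Chernoff_ineq_nn_integral_ge s) auto
  also have "(\<integral>\<^sup>+\<omega>\<in>space M. ennreal (exp (s * (\<Sum>i\<in>I. X i \<omega>))) \<partial>M)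
      = (\<integral>\<^sup>+\<omega>. (\<Prod>i\<in>I. ennreal (exp (s * X i \<omega>))) \<partial>M)"
    by (intro nn_integral_cong) (simp add: sum_distrib_left exp_sum fin prod_ennreal)
  also have "\<dots> = (\<Prod>i\<in>I. \<integral>\<^sup>+\<omega>. ennreal (exp (s * X i \<omega>)) \<partial>M)"
    by (intro indep_vars_nn_integral fin indep_vars_compose2[OF indep]) auto
  also have "\<dots> \<le> (\<Prod>i\<in>I. ennreal (m i))"
    by (intro prod_mono_ennreal mgf)
  also have "\<dots> = ennreal (\<Prod>i\<in>I. m i)"
    by (intro prod_ennreal m)
  finally show ?thesis
    using m by (simp add: mult_left_mono prod_nonneg flip: ennreal_mult)
qed

theorem proposition4:
  fixes M :: "'a measure" and X :: "nat \<Rightarrow> 'a \<Rightarrow> real"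
    and v :: "nat \<Rightarrow> real" and n :: nat and t l0 :: real
  assumes "n \<ge> 1"
    and "\<And>i. i \<in> {1..n} \<Longrightarrow> v i > 0"
    and "prob_space M"
    and "prob_space.indep_vars M (\<lambda>_. borel) X {1..n}"
    and "\<And>i. i \<in> {1..n} \<Longrightarrow>
           distributed M lborel (X i)
             (\<lambda>x. indicator {- v i..v i} x / measure lborel {- v i..v i})"
    and "t > 0"
    and "l0 > 0"
    and "((\<lambda>l. psi_tilde n v l t) has_real_derivative 0) (at l0)"
  shows "measure M {\<omega> \<in> space M. \<bar>\<Sum>i = 1..n. X i \<omega>\<bar> \<ge> t} \<le> 2 * exp (psi_tilde n v l0 t)"
proof -
  interpret prob_space M by fact
  let ?m = "\<lambda>i. sinh (l0 * v i) / (l0 * v i)"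
  let ?S = "\<lambda>\<omega>. \<Sum>i = 1..n. X i \<omega>"
  have m_pos: "?m i > 0" if "i \<in> {1..n}" for i
    using assms(2)[OF that] \<open>l0 > 0\<close> by simp
  have [measurable]: "random_variable borel (X i)" if "i \<in> {1..n}" for i
    using assms(4) that by (auto simp: indep_vars_def)
  have "exp (- l0 * t) * (\<Prod>i = 1..n. ?m i)
      = exp (- l0 * t + (\<Sum>i = 1..n. ln (?m i)))"
    unfolding exp_add exp_sum[OF finite_atLeastAtMost]
    by (intro arg_cong2[where f = "(*)"] refl prod.cong) (simp only: exp_ln[OF m_pos])
  also have "\<dots> \<le> exp (psi_tilde n v l0 t)"
    using sum_ln_sinhc_le[OF assms(1,2) \<open>l0 > 0\<close>]
      psi_tilde_eq_ln_sinhc[OF \<open>l0 > 0\<close> emp_mean_pos[OF assms(1,2)]] by simp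
  finally have bound: "exp (- l0 * t) * (\<Prod>i = 1..n. ?m i) \<le> exp (psi_tilde n v l0 t)" .
  have upper: "prob {\<omega> \<in> space M. t \<le> ?S \<omega>} \<le> exp (- l0 * t) * (\<Prod>i = 1..n. ?m i)"
    using nn_integral_exp_uniform[OF assms(2) _ assms(5)] m_pos \<open>l0 > 0\<close>
    by (intro Chernoff_indep_vars_ge assms(4)) (auto simp: less_imp_le)
  have "indep_vars (\<lambda>_. borel) (\<lambda>i \<omega>. - X i \<omega>) {1..n}"
    by (intro indep_vars_compose2[OF assms(4)]) auto
  \<comment> \<open>The function sinh y / y is even, so the parameter \<open>- l0\<close> gives the
    same value \<open>?m i\<close> as \<open>l0\<close>.\<close>
  moreover have "(\<integral>\<^sup>+\<omega>. ennreal (exp (l0 * - X i \<omega>)) \<partial>M) = ennreal (?m i)" if "i \<in> {1..n}" for i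
    using nn_integral_exp_uniform[OF assms(2) _ assms(5), OF that _ that, of "- l0"] \<open>l0 > 0\<close> by simp
  ultimately have lower:
    "prob {\<omega> \<in> space M. t \<le> (\<Sum>i = 1..n. - X i \<omega>)} \<le> exp (- l0 * t) * (\<Prod>i = 1..n. ?m i)"
    using m_pos \<open>l0 > 0\<close> by (intro Chernoff_indep_vars_ge) (auto simp: less_imp_le)
  \<comment> \<open>The factor 2 comes from the union bound over the two tails, which share the same
    estimate.\<close>
  have "{\<omega> \<in> space M. \<bar>?S \<omega>\<bar> \<ge> t}
      = {\<omega> \<in> space M. t \<le> ?S \<omega>} \<union> {\<omega> \<in> space M. t \<le> (\<Sum>i = 1..n. - X i \<omega>)}"
    by (auto simp: sum_negf)
  also have "prob \<dots> \<le> prob {\<omega> \<in> space M. t \<le> ?S \<omega>}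
      + prob {\<omega> \<in> space M. t \<le> (\<Sum>i = 1..n. - X i \<omega>)}"
    by (intro measure_Un_le) auto
  finally show ?thesis
    using upper lower bound by linarith
qed

end
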